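(* Suppose that $d\geqslant2$ and that the Lévy measure $\Lambda$ on $\mathbb{R}^d$ admits a polar decomposition $\{\zeta,\rho_{\boldsymbol{u}}:\boldsymbol{u}\in\mathscr{S}^{d-1}\}$. If (i) $\boldsymbol{0}\in\operatorname{int}\operatorname{conv}\operatorname{supp}\zeta$, (ii) $\rho_{\boldsymbol{u}}\big((0,\varepsilon)\big)>0$ for $\zeta$-almost any $\boldsymbol{u}\in\mathscr{S}^{d-1}$ and for any $\varepsilon>0$, then $\boldsymbol{0}\in\operatorname{int}\operatorname{conv}\operatorname{supp}\Lambda_\varepsilon$ for any $\varepsilon>0$.
   Context: A Lévy measure on $\mathbb{R}^d$ is a Borel measure $\Lambda$ with $\Lambda(\{\boldsymbol{0}\})=0$ and $\int\min\{1,\|\boldsymbol{x}\|^2\}\Lambda(\mathrm{d}\boldsymbol{x})<\infty$. $\mathscr{S}^{d-1}$ is the unit sphere of $\mathbb{R}^d$ and $\mathbb{R}_{++}=(0,\infty)$. $\Lambda$ admits a polar decomposition $\{\zeta,\rho_{\boldsymbol{u}}:\boldsymbol{u}\in\mathscr{S}^{d-1}\}$ if $$\Lambda(A)=\int_{\mathscr{S}^{d-1}}\int_{\mathbb{R}_{++}}\mathbf{1}_A(r\boldsymbol{u})\,\rho_{\boldsymbol{u}}(\mathrm{d}r)\,\zeta(\mathrm{d}\boldsymbol{u})\quad\text{for all Borel }A\subset\mathbb{R}^d,$$ where $\zeta$ is a finite measure on $\mathscr{S}^{d-1}$ and $\{\rho_{\boldsymbol{u}}\}$ is a family of Lévy measures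 on $\mathbb{R}_{++}$ (i.e. $\int\min\{1,r^2\}\rho_{\boldsymbol{u}}(\mathrm{d}r)<\infty$) such that $\boldsymbol{u}\mapsto\rho_{\boldsymbol{u}}(A)$ is measurable for every Borel $A\subset\mathbb{R}_{++}$. $\Lambda_\varepsilon(A)=\Lambda\big(A\cap B(\boldsymbol{0},\varepsilon)\big)$ for Borel $A\subset\mathbb{R}^d$, where $B(\boldsymbol{0},\varepsilon)$ is the open ball of radius $\varepsilon$ centred at the origin. $\operatorname{supp}$ is the closed support of a measure (viewed as a subset of $\mathbb{R}^d$), $\operatorname{conv}$ the convex hull, $\operatorname{int}$ the interior in $\mathbb{R}^d$. *)

theory Defs
  imports "HOL-Analysis.Analysis"
begin

definition levy_measure :: "'a::euclidean_space measure \<Rightarrow> bool" where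
  "levy_measure M \<longleftrightarrow>
     sets M = sets borel \<and>
     emeasure M {0} = 0 \<and>
     (\<integral>\<^sup>+x. ennreal (min 1 ((norm x)\<^sup>2)) \<partial>M) < \<infinity>"

definition levy_measure_pos :: "real measure \<Rightarrow> bool" where
  "levy_measure_pos M \<longleftrightarrow>
     sets M = sets (restrict_space borel {0<..}) \<and>
     (\<integral>\<^sup>+r. ennreal (min 1 (r\<^sup>2)) \<partial>M) < \<infinity>"

definition polar_decomposition ::
    "'a::euclidean_space measure \<Rightarrow> 'a measure \<Rightarrow> ('a \<Rightarrow> real measure) \<Rightarrow> bool" where
  "polar_decomposition \<Lambda> \<zeta> \<rho> \<longleftrightarrow>
     sets \<zeta> = sets (restrict_space borel (sphere 0 1)) \<and>
     finite_measure \<zeta> \<and>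
     (\<forall>u\<in>sphere 0 1. levy_measure_pos (\<rho> u)) \<and>
     (\<forall>A\<in>sets (restrict_space borel {0<..}). (\<lambda>u. emeasure (\<rho> u) A) \<in> borel_measurable \<zeta>) \<and>
     (\<forall>A\<in>sets borel.
        emeasure \<Lambda> A = (\<integral>\<^sup>+u. (\<integral>\<^sup>+r. indicator A (r *\<^sub>R u) \<partial>\<rho> u) \<partial>\<zeta>))"

text \<open>The space of \<open>M\<close> may be a proper subset of the ambient space (the unit sphere, say);
  the support is then that of \<open>M\<close> extended by zero to the ambient space.\<close>

definition closed_support :: "'a::topological_space measure \<Rightarrow> 'a set" where
  "closed_support M = {x. \<forall>U. open U \<longrightarrow> x \<in> U \<longrightarrow> 0 < emeasure M (U \<inter> space M)}"

definition ball_restriction :: "'a::euclidean_space measure \<Rightarrow> real \<Rightarrow> 'a measure" where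
  "ball_restriction M \<epsilon> = density M (indicator (ball 0 \<epsilon>))"

lemma emeasure_ball_restriction:
  assumes "sets M = sets borel" "A \<in> sets borel"
  shows "emeasure (ball_restriction M \<epsilon>) A = emeasure M (A \<inter> ball 0 \<epsilon>)"
proof -
  have "ball 0 \<epsilon> \<in> sets M" "A \<in> sets M"
    using assms by simp_all
  then show ?thesis
    unfolding ball_restriction_def
    by (simp add: emeasure_density flip: indicator_inter_arith)
       (simp add: Int_commute)
qed

end

theory Submission
  imports Defs
begin

text \<open>The origin is interior to \<open>conv S\<close> iff every open half-space bounded by a hyperplane through the
  origin meets \<open>S\<close>. So let \<open>a \<noteq> 0\<close> and \<open>H = {x. a \<bullet> x < 0}\<close>. By (i), \<open>H\<close> meets the support of
  \<open>\<zeta>\<close>, hence \<open>\<zeta> H > 0\<close>. As \<open>H\<close> is a cone, the polar decomposition gives that \<open>\<Lambda> (H \<inter> ball 0 \<epsilon>)\<close>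
  is the \<open>\<zeta>\<close>-integral of \<open>\<rho> u {0<..<\<epsilon>}\<close> over \<open>H\<close>, which is positive by (ii). Finally the
  complement of the support is a null set (Lindelof), so \<open>H\<close> meets the support of \<open>\<Lambda>\<close> restricted to the ball.\<close>

text \<open>Separation in two cases. A convex set with empty interior lies in a hyperplane.
  Otherwise \<open>0\<close> is separated from the interior, which is dense in
  \<open>C\<close>.\<close>

lemma zero_notin_interior_convex_imp_halfspace:
  fixes C :: "'a::euclidean_space set"
  assumes "convex C" "0 \<notin> interior C"
  obtains a where "a \<noteq> 0" "\<And>x. x \<in> C \<Longrightarrow> 0 \<le> a \<bullet> x"
proof (cases "interior C = {}")
  case True
  then obtain a b where ab: "a \<noteq> 0" "C \<subseteq> {x. a \<bullet> x = b}"
    using empty_interior_subset_hyperplane[OF assms(1)] by metis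
  show ?thesis
  \<comment> \<open>The sign of \<open>b\<close> decides whether \<open>a\<close> or
    \<open>- a\<close> is the required normal vector.\<close>
  proof (cases "0 \<le> b")
    case True
    with ab show ?thesis by (intro that[of a]) auto
  next
    case False
    with ab show ?thesis by (intro that[of "- a"]) auto
  qed
next
  case False
  obtain a where a: "a \<noteq> 0" "\<forall>x\<in>interior C. 0 \<le> a \<bullet> x"
    using separating_hyperplane_set_0[OF convex_interior[OF assms(1)] assms(2)] by blast
  \<comment> \<open>A closed half-space absorbs the closure, and a convex set with nonempty interior
    has the same closure as its interior.\<close>
  have "closure (interior C) \<subseteq> {x. 0 \<le> a \<bullet> x}"
    using a(2) closed_halfspace_ge[of 0 a] by (intro closure_minimal) auto
  then have "C \<subseteq> {x. 0 \<le> a \<bullet> x}"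
    using convex_closure_interior[OF assms(1) False] closure_subset[of C] by auto
  with a(1) show ?thesis by (intro that[of a]) auto
qed

text \<open>If \<open>S\<close> misses the open half-space, its hull lies in the closed
  complementary one, whose interior omits \<open>0\<close>. The converse is the separation lemma
  above, applied to the hull.\<close>

lemma zero_in_interior_convex_hull_iff:
  fixes S :: "'a::euclidean_space set"
  shows "0 \<in> interior (convex hull S) \<longleftrightarrow> (\<forall>a. a \<noteq> 0 \<longrightarrow> (\<exists>x\<in>S. a \<bullet> x < 0))"
proof (intro iffI allI impI)
  fix a :: 'a
  assume int: "0 \<in> interior (convex hull S)" and "a \<noteq> 0"
  show "\<exists>x\<in>S. a \<bullet> x < 0"
  proof (rule ccontr)
    assume "\<not> ?thesis"
    then have "convex hull S \<subseteq> {x. a \<bullet> x \<ge> 0}"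
      by (intro hull_minimal convex_halfspace_ge) (auto simp: not_less)
    then have "interior (convex hull S) \<subseteq> {x. a \<bullet> x > 0}"
      using interior_mono interior_halfspace_ge[OF \<open>a \<noteq> 0\<close>] by blast
    with int show False by auto
  qed
next
  assume *: "\<forall>a. a \<noteq> 0 \<longrightarrow> (\<exists>x\<in>S. a \<bullet> x < 0)"
  show "0 \<in> interior (convex hull S)"
  proof (rule ccontr)
    assume "\<not> ?thesis"
    then obtain a where "a \<noteq> 0" "\<And>x. x \<in> convex hull S \<Longrightarrow> 0 \<le> a \<bullet> x"
      using zero_notin_interior_convex_imp_halfspace[OF convex_convex_hull] by metis
    with * show False by (meson hull_inc not_less)
  qed
qed

lemma closed_support_Int_nonempty:
  fixes M :: "'a::second_countable_topology measure"
  assumes "sets M = sets borel" "A \<in> sets M" "emeasure M A > 0"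
  shows "closed_support M \<inter> A \<noteq> {}"
proof
  assume disj: "closed_support M \<inter> A = {}"
  \<comment> \<open>The union of \<open>\<F>\<close> is the complement of the support. It may be an
    uncountable union, so it is known to be null only after reduction to the countable
    \<open>\<G>\<close>.\<close>
  define \<F> where "\<F> = {U. open U \<and> emeasure M U = 0}"
  have space: "space M = UNIV"
    using sets_eq_imp_space_eq[OF assms(1)] by simp
  obtain \<G> where \<G>: "\<G> \<subseteq> \<F>" "countable \<G>" "\<Union>\<G> = \<Union>\<F>"
    by (rule Lindelof[of \<F>]) (auto simp: \<F>_def)
  have "\<Union>\<G> \<in> null_sets M"
    using \<G>(1) assms(1) by (intro null_sets_UN'[OF \<G>(2), of "\<lambda>U. U", simplified]) (auto simp: \<F>_def null_sets_def)
  moreover have "A \<subseteq> \<Union>\<G>"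
    using disj unfolding \<G>(3) \<F>_def closed_support_def space
    by (auto simp: zero_less_iff_neq_zero)
  ultimately have "A \<in> null_sets M"
    using assms(2) null_sets_subset by blast
  with assms(3) show False by auto
qed

text \<open>On the unit sphere \<open>norm (r *\<^sub>R u) = r\<close>, so for \<open>r > 0\<close>
  the point \<open>r *\<^sub>R u\<close> lies in \<open>H \<inter> ball 0 \<epsilon>\<close> iff
  \<open>u \<in> H\<close> and \<open>r < \<epsilon>\<close>. The indicator thus splits into an
  angular and a radial factor.\<close>

lemma emeasure_polar_cone_Int_ball:
  fixes \<Lambda> :: "'a::euclidean_space measure"
  assumes "polar_decomposition \<Lambda> \<zeta> \<rho>" and H: "H \<in> sets borel"
    and cone: "\<And>r x. r > 0 \<Longrightarrow> r *\<^sub>R x \<in> H \<longleftrightarrow> x \<in> H"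
  shows "emeasure \<Lambda> (H \<inter> ball 0 \<epsilon>) = (\<integral>\<^sup>+u. indicator H u * emeasure (\<rho> u) {0<..<\<epsilon>} \<partial>\<zeta>)"
proof -
  note pd = assms(1)[unfolded polar_decomposition_def]
  have space: "space \<zeta> = sphere 0 1"
    using pd sets_eq_imp_space_eq[of \<zeta>] by (simp add: space_restrict_space)
  have "(\<integral>\<^sup>+r. indicator (H \<inter> ball 0 \<epsilon>) (r *\<^sub>R u) \<partial>\<rho> u) = indicator H u * emeasure (\<rho> u) {0<..<\<epsilon>}"
    if u: "u \<in> space \<zeta>" for u
  proof -
    have "sets (\<rho> u) = sets (restrict_space borel {0<..})"
      using pd u space by (auto simp: levy_measure_pos_def)
    then have sp: "space (\<rho> u) = {0<..}" and meas: "{0<..<\<epsilon>} \<in> sets (\<rho> u)"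
      using sets_eq_imp_space_eq[of "\<rho> u"]
      by (auto simp: space_restrict_space sets_restrict_space_iff)
    have "(\<integral>\<^sup>+r. indicator (H \<inter> ball 0 \<epsilon>) (r *\<^sub>R u) \<partial>\<rho> u)
        = (\<integral>\<^sup>+r. indicator H u * indicator {0<..<\<epsilon>} r \<partial>\<rho> u)"
      using u cone by (intro nn_integral_cong) (auto simp: sp space indicator_def)
    also have "\<dots> = indicator H u * emeasure (\<rho> u) {0<..<\<epsilon>}"
      using meas by (simp add: nn_integral_cmult_indicator)
    finally show ?thesis .
  qed
  moreover have "H \<inter> ball 0 \<epsilon> \<in> sets borel"
    using H by auto
  ultimately show ?thesis
    using pd by (simp cong: nn_integral_cong)
qed

theorem proposition3p11:
  fixes \<Lambda> :: "(real ^ 'd) measure"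
    and \<zeta> :: "(real ^ 'd) measure"
    and \<rho> :: "real ^ 'd \<Rightarrow> real measure"
  assumes "CARD('d) \<ge> 2"
    and "levy_measure \<Lambda>"
    and "polar_decomposition \<Lambda> \<zeta> \<rho>"
    and "0 \<in> interior (convex hull (closed_support \<zeta>))"
    and "AE u in \<zeta>. \<forall>\<epsilon>>0. emeasure (\<rho> u) {0<..<\<epsilon>} > 0"
  shows "\<forall>\<epsilon>>0. 0 \<in> interior (convex hull (closed_support (ball_restriction \<Lambda> \<epsilon>)))"
  unfolding zero_in_interior_convex_hull_iff
proof (intro allI impI)
  fix \<epsilon> :: real and a :: "real ^ 'd"
  assume "\<epsilon> > 0" "a \<noteq> 0"
  note pd = assms(3)[unfolded polar_decomposition_def]
  define H where "H = {x. a \<bullet> x < 0}"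
  have "open H"
    unfolding H_def by (rule open_halfspace_lt)
  then have H: "H \<in> sets borel"
    by simp
  have sets\<Lambda>: "sets \<Lambda> = sets borel"
    using assms(2) by (simp add: levy_measure_def)
  have sets\<zeta>: "sets \<zeta> = sets (restrict_space borel (sphere 0 1))"
    using pd by simp
  then have space\<zeta>: "space \<zeta> = sphere 0 1"
    using sets_eq_imp_space_eq[of \<zeta>] by (simp add: space_restrict_space)
  \<comment> \<open>\<open>H\<close> is not contained in the sphere, so only its trace on
    \<open>space \<zeta>\<close> is a measurable set of \<open>\<zeta>\<close>.\<close>
  have H\<zeta>: "H \<inter> space \<zeta> \<in> sets \<zeta>"
    using H by (auto simp: sets\<zeta> space\<zeta> sets_restrict_space)
  obtain u where "u \<in> closed_support \<zeta>" "u \<in> H"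
    using assms(4) \<open>a \<noteq> 0\<close> by (auto simp: zero_in_interior_convex_hull_iff H_def)
  with \<open>open H\<close> have pos: "emeasure \<zeta> (H \<inter> space \<zeta>) > 0"
    by (auto simp: closed_support_def)
  have "emeasure \<Lambda> (H \<inter> ball 0 \<epsilon>) \<noteq> 0"
  proof
    assume "emeasure \<Lambda> (H \<inter> ball 0 \<epsilon>) = 0"
    then have "(\<integral>\<^sup>+u. indicator H u * emeasure (\<rho> u) {0<..<\<epsilon>} \<partial>\<zeta>) = 0"
      using emeasure_polar_cone_Int_ball[OF assms(3) H, of \<epsilon>]
      by (simp add: H_def mult_less_0_iff)
    moreover have "(\<lambda>u. emeasure (\<rho> u) {0<..<\<epsilon>}) \<in> borel_measurable \<zeta>"
    proof -
      have "{0<..<\<epsilon>} \<in> sets (restrict_space borel {0<..})"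
        by (auto simp: sets_restrict_space_iff)
      with pd show ?thesis by blast
    qed
    moreover have "(indicator H :: _ \<Rightarrow> ennreal) \<in> borel_measurable \<zeta>"
      using H\<zeta> by (subst borel_measurable_indicator_iff)
    ultimately have "AE u in \<zeta>. indicator H u * emeasure (\<rho> u) {0<..<\<epsilon>} = 0"
      by (subst (asm) nn_integral_0_iff_AE) auto
    \<comment> \<open>By (ii) the radial factor is almost everywhere positive, so the product can
      vanish only through \<open>indicator H u\<close>.\<close>
    with assms(5) have "AE u in \<zeta>. u \<notin> H"
      by eventually_elim (use \<open>\<epsilon> > 0\<close> in \<open>auto simp: indicator_def split: if_splits\<close>)
    then have "emeasure \<zeta> (H \<inter> space \<zeta>) = 0"
      by (intro AE_iff_measurable[THEN iffD1, OF H\<zeta>]) auto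
    with pos show False by simp
  qed
  then have "emeasure (ball_restriction \<Lambda> \<epsilon>) H > 0"
    using emeasure_ball_restriction[OF sets\<Lambda> H] by (simp add: zero_less_iff_neq_zero)
  moreover have "sets (ball_restriction \<Lambda> \<epsilon>) = sets borel"
    by (simp add: ball_restriction_def sets\<Lambda>)
  ultimately have "closed_support (ball_restriction \<Lambda> \<epsilon>) \<inter> H \<noteq> {}"
    using H by (intro closed_support_Int_nonempty) auto
  then show "\<exists>x\<in>closed_support (ball_restriction \<Lambda> \<epsilon>). a \<bullet> x < 0"
    by (auto simp: H_def)
qed

end
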